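(* There exist a complex, infinite-dimensional, separable Hilbert space $\mathcal{H}$ and an irreducible unital semigroup $\mathcal{S} \subseteq \mathcal{B}(\mathcal{H})$ of isometries such that $\mathcal{P}(\mathcal{S}) \cup \mathcal{Q}(\mathcal{S})$ is a commuting set of projections and $\mathcal{S}$ cannot be enlarged to a selfadjoint semigroup of partial isometries; that is, there is no semigroup $\mathcal{T} \subseteq \mathcal{B}(\mathcal{H})$ consisting of partial isometries with $\mathcal{S} \subseteq \mathcal{T}$ and $\mathcal{T} = \mathcal{T}^*$.
   Context: $\mathcal{B}(\mathcal{H})$ is the algebra of bounded linear operators on $\mathcal{H}$. A semigroup in $\mathcal{B}(\mathcal{H})$ is a non-empty subset closed under operator multiplication; it is unital if it contains the identity operator $I$. A partial isometry is an operator $V$ such that $VV^*$ (equivalently $V^*V$) is an orthogonal projection; $Q_V := VV^*$ is its range projection and $P_V := V^*V$ its initial projection. $\mathcal{P}(\mathcal{S}) = \{P_S : S\in\mathcal{S}\}$, $\mathcal{Q}(\mathcal{S}) = \{Q_S : S \in \mathcal{S}\}$, and $\mathcal{T}^*=\{T^*:T\in\mathcal{T}\}$. $\mathcal{S}$ is irreducible if the only closed subspaces of $\mathcal{H}$ invariant under every element of $\mathcal{S}$ are $\{0\}$ and $\mathcal{H}$. *)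

theory Defs
  imports "HOL-Analysis.Analysis" "HOL-Algebra.Algebraic_Closure_Type"
begin

text \<open>
  Hilbert spaces are carrier-based structures in the style of HOL-Algebra, so that one can
  quantify over them inside a formula. The ring structure on \<complex> is the library's
  \<^const>\<open>ring_of_type_algebra\<close>; the multiplicative fields that the record inherits from
  \<^typ>\<open>'a ring\<close> are unused, as for every HOL-Algebra module.

  For separable spaces, carriers of type \<^typ>\<open>(nat \<Rightarrow> complex) set\<close> lose no generality: such a
  space has at most the cardinality of the continuum, so it is isomorphic to one carried by
  a set of complex sequences.
\<close>

abbreviation complex_ring :: "complex ring"
  where "complex_ring \<equiv> ring_of_type_algebra"

record 'a hilbert = "(complex, 'a) module" +
  ip :: "'a \<Rightarrow> 'a \<Rightarrow> complex"

locale complex_inner_product_space = Module.module complex_ring H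
  for H :: "('a, 'm) hilbert_scheme" (structure) +
  assumes ip_add: "\<lbrakk>x \<in> carrier H; y \<in> carrier H; z \<in> carrier H\<rbrakk>
      \<Longrightarrow> ip H (x \<oplus> y) z = ip H x z + ip H y z"
    and ip_smult: "\<lbrakk>x \<in> carrier H; y \<in> carrier H\<rbrakk> \<Longrightarrow> ip H (c \<odot> x) y = c * ip H x y"
    and ip_cnj: "\<lbrakk>x \<in> carrier H; y \<in> carrier H\<rbrakk> \<Longrightarrow> ip H y x = cnj (ip H x y)"
    and ip_pos: "\<lbrakk>x \<in> carrier H; x \<noteq> \<zero>\<rbrakk> \<Longrightarrow> 0 < Re (ip H x x)"

definition hnorm :: "('a, 'm) hilbert_scheme \<Rightarrow> 'a \<Rightarrow> real"
  where "hnorm H x = sqrt (Re (ip H x x))"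

text \<open>The locale \<^locale>\<open>Metric_space\<close> asks for nonnegativity and symmetry on the whole type,
  hence the default value outside the carrier.\<close>

definition hdist :: "('a, 'm) hilbert_scheme \<Rightarrow> 'a \<Rightarrow> 'a \<Rightarrow> real"
  where "hdist H x y =
    (if x \<in> carrier H \<and> y \<in> carrier H then hnorm H (x \<ominus>\<^bsub>H\<^esub> y) else 0)"

abbreviation htopology :: "('a, 'm) hilbert_scheme \<Rightarrow> 'a topology"
  where "htopology H \<equiv> Metric_space.mtopology (carrier H) (hdist H)"

locale complex_hilbert_space = complex_inner_product_space +
  assumes complete: "Metric_space.mcomplete (carrier H) (hdist H)"

definition infinite_dimensional :: "('a, 'm) hilbert_scheme \<Rightarrow> bool"
  where "infinite_dimensional H \<longleftrightarrow>
    \<not> (\<exists>B. finite B \<and> B \<subseteq> carrier H \<and>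
         (\<lambda>M. submodule M complex_ring H) hull B = carrier H)"

definition closed_subspace :: "('a, 'm) hilbert_scheme \<Rightarrow> 'a set \<Rightarrow> bool"
  where "closed_subspace H M \<longleftrightarrow> submodule M complex_ring H \<and> closedin (htopology H) M"

text \<open>Operators are extensional functions on the carrier (undefined outside it), so that
  HOL equality of operators is equality of maps on the space, and the product is
  \<^const>\<open>compose\<close>.\<close>

definition bounded_operators :: "('a, 'm) hilbert_scheme \<Rightarrow> ('a \<Rightarrow> 'a) set"
  where "bounded_operators H =
    {T \<in> carrier H \<rightarrow>\<^sub>E carrier H.
       (\<forall>x\<in>carrier H. \<forall>y\<in>carrier H. T (x \<oplus>\<^bsub>H\<^esub> y) = T x \<oplus>\<^bsub>H\<^esub> T y) \<and>
       (\<forall>c. \<forall>x\<in>carrier H. T (c \<odot>\<^bsub>H\<^esub> x) = c \<odot>\<^bsub>H\<^esub> T x) \<and>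
       (\<exists>K. \<forall>x\<in>carrier H. hnorm H (T x) \<le> K * hnorm H x)}"

definition id_op :: "('a, 'm) hilbert_scheme \<Rightarrow> 'a \<Rightarrow> 'a"
  where "id_op H = (\<lambda>x\<in>carrier H. x)"

text \<open>On a Hilbert space the description is satisfied by exactly one operator
  whenever \<open>T\<close> is bounded (Riesz).\<close>

definition adj :: "('a, 'm) hilbert_scheme \<Rightarrow> ('a \<Rightarrow> 'a) \<Rightarrow> 'a \<Rightarrow> 'a"
  where "adj H T = (THE T'. T' \<in> bounded_operators H \<and>
    (\<forall>x\<in>carrier H. \<forall>y\<in>carrier H. ip H (T x) y = ip H x (T' y)))"

definition orthogonal_projection :: "('a, 'm) hilbert_scheme \<Rightarrow> ('a \<Rightarrow> 'a) \<Rightarrow> bool"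
  where "orthogonal_projection H E \<longleftrightarrow>
    E \<in> bounded_operators H \<and> compose (carrier H) E E = E \<and> adj H E = E"

definition range_proj :: "('a, 'm) hilbert_scheme \<Rightarrow> ('a \<Rightarrow> 'a) \<Rightarrow> 'a \<Rightarrow> 'a"
  where "range_proj H V = compose (carrier H) V (adj H V)"

definition init_proj :: "('a, 'm) hilbert_scheme \<Rightarrow> ('a \<Rightarrow> 'a) \<Rightarrow> 'a \<Rightarrow> 'a"
  where "init_proj H V = compose (carrier H) (adj H V) V"

definition partial_isometry :: "('a, 'm) hilbert_scheme \<Rightarrow> ('a \<Rightarrow> 'a) \<Rightarrow> bool"
  where "partial_isometry H V \<longleftrightarrow>
    V \<in> bounded_operators H \<and> orthogonal_projection H (range_proj H V)"

definition isometry :: "('a, 'm) hilbert_scheme \<Rightarrow> ('a \<Rightarrow> 'a) \<Rightarrow> bool"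
  where "isometry H V \<longleftrightarrow>
    V \<in> bounded_operators H \<and> (\<forall>x\<in>carrier H. hnorm H (V x) = hnorm H x)"

definition operator_semigroup :: "('a, 'm) hilbert_scheme \<Rightarrow> ('a \<Rightarrow> 'a) set \<Rightarrow> bool"
  where "operator_semigroup H S \<longleftrightarrow>
    S \<noteq> {} \<and> S \<subseteq> bounded_operators H \<and> (\<forall>A\<in>S. \<forall>B\<in>S. compose (carrier H) A B \<in> S)"

definition irreducible_on :: "('a, 'm) hilbert_scheme \<Rightarrow> ('a \<Rightarrow> 'a) set \<Rightarrow> bool"
  where "irreducible_on H S \<longleftrightarrow>
    (\<forall>M. closed_subspace H M \<and> (\<forall>T\<in>S. T ` M \<subseteq> M) \<longrightarrow> M = {\<zero>\<^bsub>H\<^esub>} \<or> M = carrier H)"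

definition commuting_projections :: "('a, 'm) hilbert_scheme \<Rightarrow> ('a \<Rightarrow> 'a) set \<Rightarrow> bool"
  where "commuting_projections H \<E> \<longleftrightarrow>
    (\<forall>E\<in>\<E>. orthogonal_projection H E) \<and>
    (\<forall>E\<in>\<E>. \<forall>F\<in>\<E>. compose (carrier H) E F = compose (carrier H) F E)"


text \<open>The distance function does define a metric.\<close>

context complex_inner_product_space
begin

lemma ip_zero_left: "y \<in> carrier H \<Longrightarrow> ip H \<zero> y = 0"
  using ip_add[of \<zero> \<zero> y] by simp

lemma ip_self_nonneg: "x \<in> carrier H \<Longrightarrow> 0 \<le> Re (ip H x x)"
  using ip_pos[of x] ip_zero_left[of x] by (cases "x = \<zero>") auto

lemma smult_closed': "x \<in> carrier H \<Longrightarrow> c \<odot> x \<in> carrier H"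
  using smult_closed[of c x] by (simp add: ring_of_type_algebra_def)

lemma ip_minus: "\<lbrakk>x \<in> carrier H; y \<in> carrier H\<rbrakk> \<Longrightarrow> ip H (\<ominus> x) y = - ip H x y"
  using ip_add[of x "\<ominus> x" y] ip_zero_left[of y]
  by (simp add: M.r_neg eq_neg_iff_add_eq_0 add.commute)

lemma ip_add_right: "\<lbrakk>x \<in> carrier H; y \<in> carrier H; z \<in> carrier H\<rbrakk>
    \<Longrightarrow> ip H x (y \<oplus> z) = ip H x y + ip H x z"
  by (metis M.a_closed complex_cnj_add ip_add ip_cnj)

lemma ip_smult_right: "\<lbrakk>x \<in> carrier H; y \<in> carrier H\<rbrakk>
    \<Longrightarrow> ip H x (c \<odot> y) = cnj c * ip H x y"
  by (metis complex_cnj_mult ip_smult ip_cnj smult_closed')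

lemma ip_self_real: "x \<in> carrier H \<Longrightarrow> ip H x x = of_real (Re (ip H x x))"
  using ip_cnj[of x x] by (simp add: complex_eq_iff)

lemma hnorm_sq: "x \<in> carrier H \<Longrightarrow> (hnorm H x)\<^sup>2 = Re (ip H x x)"
  by (simp add: hnorm_def ip_self_nonneg)

lemma hnorm_nonneg: "x \<in> carrier H \<Longrightarrow> 0 \<le> hnorm H x"
  by (simp add: hnorm_def ip_self_nonneg)

lemma hnorm_eq_0: "x \<in> carrier H \<Longrightarrow> hnorm H x = 0 \<longleftrightarrow> x = \<zero>"
  using ip_pos[of x] ip_zero_left[of \<zero>] by (cases "x = \<zero>") (auto simp: hnorm_def)

lemma Cauchy_Schwarz:
  assumes [simp]: "x \<in> carrier H" "y \<in> carrier H"
  shows "cmod (ip H x y) \<le> hnorm H x * hnorm H y"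
proof (cases "y = \<zero>")
  case True
  then show ?thesis
    using ip_zero_left[of x] ip_cnj[of y x] by (simp add: hnorm_nonneg)
next
  case False
  define b where "b = Re (ip H y y)"
  have b: "b > 0" using ip_pos False by (simp add: b_def)
  define p where "p = ip H x y"
  define c where "c = - p / of_real b"
  have [simp]: "c \<odot> y \<in> carrier H" by (simp add: smult_closed')
  have "ip H (x \<oplus> c \<odot> y) (x \<oplus> c \<odot> y)
      = ip H x x + cnj c * p + c * cnj p + c * cnj c * of_real b"
    using ip_self_real[of y] ip_cnj[of x y]
    by (simp add: ip_add ip_add_right ip_smult ip_smult_right p_def b_def algebra_simps)
  also have "\<dots> = ip H x x - p * cnj p / of_real b"
    using b by (simp add: c_def field_simps)
  also have "\<dots> = ip H x x - of_real ((cmod p)\<^sup>2 / b)"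
    by (simp only: complex_norm_square of_real_divide)
  finally have "Re (ip H (x \<oplus> c \<odot> y) (x \<oplus> c \<odot> y)) = Re (ip H x x) - (cmod p)\<^sup>2 / b"
    by simp
  then have "(cmod p)\<^sup>2 / b \<le> Re (ip H x x)"
    using ip_self_nonneg[of "x \<oplus> c \<odot> y"] by simp
  then have "(cmod p)\<^sup>2 \<le> (hnorm H x * hnorm H y)\<^sup>2"
    using b by (simp add: hnorm_sq power_mult_distrib b_def field_simps)
  then show ?thesis
    unfolding p_def by (rule power2_le_imp_le) (simp add: hnorm_nonneg)
qed

lemma hnorm_triangle:
  assumes [simp]: "x \<in> carrier H" "y \<in> carrier H"
  shows "hnorm H (x \<oplus> y) \<le> hnorm H x + hnorm H y"
proof (rule power2_le_imp_le)
  have "(hnorm H (x \<oplus> y))\<^sup>2 = (hnorm H x)\<^sup>2 + (hnorm H y)\<^sup>2 + 2 * Re (ip H x y)"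
    using ip_cnj[of x y] by (simp add: hnorm_sq ip_add ip_add_right)
  also have "Re (ip H x y) \<le> hnorm H x * hnorm H y"
    using Cauchy_Schwarz[of x y] complex_Re_le_cmod[of "ip H x y"] by simp
  finally show "(hnorm H (x \<oplus> y))\<^sup>2 \<le> (hnorm H x + hnorm H y)\<^sup>2"
    by (simp add: power2_sum)
qed (simp add: hnorm_nonneg)

lemma hnorm_minus: "x \<in> carrier H \<Longrightarrow> hnorm H (\<ominus> x) = hnorm H x"
  using ip_cnj[of "\<ominus> x" x] ip_minus[of x "\<ominus> x"] ip_minus[of x x]
  by (simp add: hnorm_def)

sublocale metric: Metric_space "carrier H" "hdist H"
proof
  show "0 \<le> hdist H x y" for x y
    by (simp add: hdist_def hnorm_nonneg)
  show "hdist H x y = hdist H y x" for x y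
    using hnorm_minus[of "x \<ominus> y"]
    by (auto simp: hdist_def M.minus_add a_minus_def M.a_comm)
  show "hdist H x y = 0 \<longleftrightarrow> x = y" if "x \<in> carrier H" "y \<in> carrier H" for x y
    using that M.minus_equality[of x "\<ominus> y"] M.minus_minus[of y]
    by (auto simp: hdist_def hnorm_eq_0 a_minus_def M.r_neg)
  show "hdist H x z \<le> hdist H x y + hdist H y z"
    if [simp]: "x \<in> carrier H" "y \<in> carrier H" "z \<in> carrier H" for x y z
  proof -
    have "x \<ominus> z = (x \<ominus> y) \<oplus> (y \<ominus> z)"
      by (simp add: a_minus_def M.a_assoc M.r_neg1)
    then show ?thesis
      using hnorm_triangle[of "x \<ominus> y" "y \<ominus> z"] by (simp add: hdist_def)
  qed
qed

end

end

theory Submission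
  imports Defs "HOL-Library.Function_Algebras"
begin

text \<open>
  Index an orthonormal basis of $\ell^2$ by pairs $(a, k)$ and let $H_A$, for $A \subseteq \<nat>$, be the closed
  span of the basis vectors with $a \in A$. The isometries that map every $H_A$ onto some $H_B$ form a
  unital semigroup, and their range projections commute, being projections onto subspaces $H_B$.
  It contains the reflections $1 - 2 u u^*$ for unit vectors $u$ in a single block $H_{\{a\}}$ and
  the permutations of the basis that permute rows and columns; together these act irreducibly.

  The semigroup also contains a permutation $V$ that spreads block $0$ over the blocks $0$ and $1$,
  and an isometry $W$ whose range misses block $0$. In a selfadjoint extension, $V^* W W^* V$ is a
  projection that splits block $0$, so it fails to commute with its conjugate by a reflection $R$ that mixes
  the two halves. Concretely, $Z = W^* V R V^* W$ is selfadjoint with an eigenvalue $7/25$, so it is not a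
  partial isometry.
\<close>

section \<open>Operators on complex inner product spaces\<close>

context complex_inner_product_space
begin

lemma ip_minus_right: "\<lbrakk>x \<in> carrier H; y \<in> carrier H\<rbrakk> \<Longrightarrow> ip H x (\<ominus> y) = - ip H x y"
  by (metis M.a_inv_closed complex_cnj_minus ip_cnj ip_minus)

text \<open>Testing with \<open>x \<ominus> y\<close> gives distance zero. Linearity of adjoints and
  of reflections is checked by this principle below.\<close>

lemma ip_eqI:
  assumes [simp]: "x \<in> carrier H" "y \<in> carrier H"
    and eq: "\<And>z. z \<in> carrier H \<Longrightarrow> ip H z x = ip H z y"
  shows "x = y"
proof -
  have "ip H (x \<ominus> y) (x \<ominus> y) = 0"
    using eq[of "x \<ominus> y"] by (simp add: a_minus_def ip_add_right ip_minus_right)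
  then have "hdist H x y = 0"
    by (simp add: hdist_def hnorm_def)
  then show ?thesis
    by simp
qed

lemma bounded_operatorD:
  assumes "T \<in> bounded_operators H"
  shows "x \<in> carrier H \<Longrightarrow> T x \<in> carrier H"
    and "T \<in> extensional (carrier H)"
    and "\<lbrakk>x \<in> carrier H; y \<in> carrier H\<rbrakk> \<Longrightarrow> T (x \<oplus> y) = T x \<oplus> T y"
    and "x \<in> carrier H \<Longrightarrow> T (c \<odot> x) = c \<odot> T x"
  using assms by (auto simp: bounded_operators_def PiE_def)

text \<open>Replacing the constant by its absolute value makes it nonnegative, so that bounds can be
  multiplied when operators are composed.\<close>

lemma bounded_operator_bound:
  assumes "T \<in> bounded_operators H"
  shows "\<exists>K\<ge>0. \<forall>x\<in>carrier H. hnorm H (T x) \<le> K * hnorm H x"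
proof -
  obtain K where K: "\<forall>x\<in>carrier H. hnorm H (T x) \<le> K * hnorm H x"
    using assms by (auto simp: bounded_operators_def)
  have "hnorm H (T x) \<le> \<bar>K\<bar> * hnorm H x" if "x \<in> carrier H" for x
    by (rule order_trans[OF bspec[OF K that] mult_right_mono]) (simp_all add: hnorm_nonneg that)
  then show ?thesis
    by (intro exI[of _ "\<bar>K\<bar>"]) simp
qed

lemma bounded_operator_compose:
  assumes "S \<in> bounded_operators H" "T \<in> bounded_operators H"
  shows "compose (carrier H) S T \<in> bounded_operators H"
proof -
  obtain K where K: "K \<ge> 0" "\<And>x. x \<in> carrier H \<Longrightarrow> hnorm H (S x) \<le> K * hnorm H x"
    using bounded_operator_bound[OF assms(1)] by blast
  obtain L where L: "L \<ge> 0" "\<And>x. x \<in> carrier H \<Longrightarrow> hnorm H (T x) \<le> L * hnorm H x"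
    using bounded_operator_bound[OF assms(2)] by blast
  have "hnorm H (S (T x)) \<le> K * L * hnorm H x" if "x \<in> carrier H" for x
  proof -
    have "hnorm H (S (T x)) \<le> K * hnorm H (T x)"
      using that K bounded_operatorD[OF assms(2)] by simp
    also have "\<dots> \<le> K * (L * hnorm H x)"
      by (rule mult_left_mono) (use that K L in auto)
    finally show ?thesis by (simp add: mult.assoc)
  qed
  then have "\<exists>M. \<forall>x\<in>carrier H. hnorm H (S (T x)) \<le> M * hnorm H x"
    by blast
  then show ?thesis
    using bounded_operatorD[OF assms(1)] bounded_operatorD[OF assms(2)]
    by (auto simp: bounded_operators_def compose_def smult_closed')
qed

text \<open>The definite description in \<open>adj\<close> calls for existence and uniqueness; an
  explicit candidate \<open>W\<close> supplies existence without the Riesz theorem. Linearity of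
  \<open>W\<close> follows from the adjoint relation by testing against all vectors. For
  boundedness, the squared norm of \<open>W y\<close> is the real part of
  \<open>ip H (T (W y)) y\<close>, and Cauchy-Schwarz bounds this by \<open>K\<close> times the
  norms of \<open>W y\<close> and \<open>y\<close>.\<close>

lemma adjI:
  assumes T: "T \<in> bounded_operators H" and W: "W \<in> carrier H \<rightarrow>\<^sub>E carrier H"
    and eq: "\<And>x y. \<lbrakk>x \<in> carrier H; y \<in> carrier H\<rbrakk> \<Longrightarrow> ip H (T x) y = ip H x (W y)"
  shows "W \<in> bounded_operators H" "adj H T = W"
proof -
  note [simp] = bounded_operatorD(1)[OF T] smult_closed'
  have [simp]: "W x \<in> carrier H" if "x \<in> carrier H" for x
    using W that by auto
  obtain K where K: "K \<ge> 0" "\<And>x. x \<in> carrier H \<Longrightarrow> hnorm H (T x) \<le> K * hnorm H x"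
    using bounded_operator_bound[OF T] by blast
  have "hnorm H (W y) \<le> K * hnorm H y" if [simp]: "y \<in> carrier H" for y
  proof (cases "hnorm H (W y) = 0")
    case False
    then have pos: "0 < hnorm H (W y)"
      using hnorm_nonneg[of "W y"] by simp
    have "hnorm H (W y) * hnorm H (W y) = Re (ip H (T (W y)) y)"
      using hnorm_sq[of "W y"] by (simp add: eq power2_eq_square)
    also have "\<dots> \<le> hnorm H (T (W y)) * hnorm H y"
      using Cauchy_Schwarz[of "T (W y)" y] complex_Re_le_cmod[of "ip H (T (W y)) y"] by simp
    also have "\<dots> \<le> (K * hnorm H (W y)) * hnorm H y"
      by (rule mult_right_mono) (simp_all add: K hnorm_nonneg)
    finally have "hnorm H (W y) * hnorm H (W y) \<le> hnorm H (W y) * (K * hnorm H y)"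
      by (simp add: ac_simps)
    then show ?thesis
      using pos by simp
  qed (use that K in \<open>simp add: hnorm_nonneg\<close>)
  moreover have "W (x \<oplus> y) = W x \<oplus> W y" if [simp]: "x \<in> carrier H" "y \<in> carrier H" for x y
    by (rule ip_eqI) (simp_all add: ip_add_right flip: eq)
  moreover have "W (c \<odot> x) = c \<odot> W x" if [simp]: "x \<in> carrier H" for c x
    by (rule ip_eqI) (simp_all add: ip_smult_right flip: eq)
  ultimately show "W \<in> bounded_operators H"
    using W by (auto simp: bounded_operators_def)
  then show "adj H T = W"
    unfolding adj_def
  proof (intro the_equality conjI ballI)
    fix W' assume W': "W' \<in> bounded_operators H \<and>
        (\<forall>x\<in>carrier H. \<forall>y\<in>carrier H. ip H (T x) y = ip H x (W' y))"
    show "W' = W"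
    proof (rule extensionalityI)
      show "W' x = W x" if [simp]: "x \<in> carrier H" for x
        by (rule ip_eqI) (use W' in \<open>simp_all add: bounded_operatorD flip: eq\<close>)
    qed (use W' W in \<open>auto simp: bounded_operatorD PiE_def\<close>)
  qed (use eq in auto)
qed

lemma Re_ip_polarization:
  assumes "x \<in> carrier H" "y \<in> carrier H"
  shows "2 * Re (ip H x y) = (hnorm H (x \<oplus> y))\<^sup>2 - (hnorm H x)\<^sup>2 - (hnorm H y)\<^sup>2"
  using assms ip_cnj[of x y] by (simp add: hnorm_sq ip_add ip_add_right)

text \<open>Polarization recovers the real part from norms. Replacing \<open>y\<close> by
  \<open>\<i> \<odot> y\<close> turns the imaginary part into a real part, since the inner product
  is conjugate-linear in its second argument.\<close>

lemma isometry_ip: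
  assumes V: "isometry H V" and [simp]: "x \<in> carrier H" "y \<in> carrier H"
  shows "ip H (V x) (V y) = ip H x y"
proof -
  have V': "V \<in> bounded_operators H"
    and [simp]: "\<And>x. x \<in> carrier H \<Longrightarrow> hnorm H (V x) = hnorm H x"
    using V by (auto simp: isometry_def)
  note [simp] = bounded_operatorD(1)[OF V'] smult_closed'
  have Re: "Re (ip H (V x) (V z)) = Re (ip H x z)" if [simp]: "z \<in> carrier H" for z
    using Re_ip_polarization[of x z] Re_ip_polarization[of "V x" "V z"]
    by (simp flip: bounded_operatorD(3)[OF V'])
  show ?thesis
    using Re[of y] Re[of "\<i> \<odot> y"]
    by (simp add: bounded_operatorD(4)[OF V'] ip_smult_right complex_eq_iff)
qed

lemma isometry_compose:
  assumes "isometry H V" "isometry H W"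
  shows "isometry H (compose (carrier H) V W)"
  using assms bounded_operator_compose[of V W] bounded_operatorD(1)[of W]
  by (auto simp: isometry_def compose_eq)

lemma isometry_id: "isometry H (id_op H)"
  by (auto simp: isometry_def bounded_operators_def id_op_def smult_closed' intro: exI[of _ 1])

text \<open>The hypotheses say that \<open>E\<close> is the orthogonal projection onto the range of
  \<open>V\<close>: it maps into that range, and \<open>y\<close> differs from \<open>E y\<close> by
  a vector orthogonal to it. The adjoint is therefore \<open>E\<close> followed by the inverse of
  \<open>V\<close> on its range.\<close>

lemma isometry_adj:
  assumes V: "isometry H V"
    and E: "E \<in> carrier H \<rightarrow>\<^sub>E V ` carrier H"
    and ip_E: "\<And>x y. \<lbrakk>x \<in> carrier H; y \<in> carrier H\<rbrakk> \<Longrightarrow> ip H (V x) (E y) = ip H (V x) y"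
  shows "\<And>x y. \<lbrakk>x \<in> carrier H; y \<in> carrier H\<rbrakk> \<Longrightarrow> ip H (V x) y = ip H x (adj H V y)"
    and "init_proj H V = id_op H" and "range_proj H V = E"
proof -
  have V': "V \<in> bounded_operators H"
    using V by (auto simp: isometry_def)
  note [simp] = bounded_operatorD(1)[OF V']
  define W where "W = (\<lambda>y\<in>carrier H. inv_into (carrier H) V (E y))"
  have VW: "V (W y) = E y" and W: "W y \<in> carrier H" if "y \<in> carrier H" for y
    using that E by (auto simp: W_def intro!: f_inv_into_f inv_into_into)
  have WE: "W \<in> carrier H \<rightarrow>\<^sub>E carrier H"
    using W by (auto simp: W_def)
  have eq: "ip H (V x) y = ip H x (W y)" if "x \<in> carrier H" "y \<in> carrier H" for x y
    using that isometry_ip[OF V, of x "W y"] by (simp add: VW W ip_E)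
  have adj: "adj H V = W"
    by (rule adjI(2)[OF V' WE eq])
  show "ip H (V x) y = ip H x (adj H V y)" if "x \<in> carrier H" "y \<in> carrier H" for x y
    using that by (simp add: adj eq)
  have "W (V x) = x" if "x \<in> carrier H" for x
    by (rule ip_eqI) (simp_all add: that W isometry_ip[OF V] flip: eq)
  then show "init_proj H V = id_op H"
    by (auto simp: init_proj_def id_op_def compose_def adj)
  show "range_proj H V = E"
    unfolding range_proj_def adj
    by (rule extensionalityI[of _ "carrier H"]) (use E in \<open>auto simp: compose_def VW PiE_def\<close>)
qed

text \<open>Since \<open>Z\<close> is its own adjoint, its range projection is the square of
  \<open>Z\<close>; idempotence at the eigenvector gives the equation. It leaves only 0, 1 and -1 as
  eigenvalues, so any other one excludes a partial isometry.\<close>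

lemma selfadjoint_partial_isometry_eigenvalue:
  assumes Z: "partial_isometry H Z"
    and sym: "\<And>x y. \<lbrakk>x \<in> carrier H; y \<in> carrier H\<rbrakk> \<Longrightarrow> ip H (Z x) y = ip H x (Z y)"
    and e [simp]: "e \<in> carrier H" "e \<noteq> \<zero>" and Ze: "Z e = c \<odot> e"
  shows "c ^ 4 = c ^ 2"
proof -
  have Z': "Z \<in> bounded_operators H"
    using Z by (simp add: partial_isometry_def)
  have adj: "adj H Z = Z"
    by (rule adjI(2)[OF Z' _ sym]) (use Z' in \<open>auto simp: bounded_operators_def\<close>)
  have Zc: "Z (a \<odot> e) = a \<odot> (c \<odot> e)" for a
    by (simp add: bounded_operatorD(4)[OF Z'] Ze)
  have pow: "a \<odot> (b \<odot> e) = (a * b) \<odot> e" for a b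
    using smult_assoc1[of a b e] by (simp add: ring_of_type_algebra_def)
  have "range_proj H Z (range_proj H Z e) = range_proj H Z e"
    using Z fun_cong[of "compose (carrier H) (range_proj H Z) (range_proj H Z)" "range_proj H Z" e]
    unfolding partial_isometry_def orthogonal_projection_def by (metis compose_eq e(1))
  then have "c ^ 4 \<odot> e = c ^ 2 \<odot> e"
    by (simp add: range_proj_def adj compose_eq smult_closed' Zc Ze pow eval_nat_numeral ac_simps)
  then have "c ^ 4 * ip H e e = c ^ 2 * ip H e e"
    by (metis e(1) ip_smult)
  then show ?thesis
    using ip_pos[of e] by auto
qed

end

section \<open>Householder reflections in a unit vector\<close>

definition reflection :: "('a, 'm) hilbert_scheme \<Rightarrow> 'a \<Rightarrow> 'a \<Rightarrow> 'a"
  where "reflection H u = (\<lambda>x\<in>carrier H. x \<oplus>\<^bsub>H\<^esub> (- 2 * ip H x u) \<odot>\<^bsub>H\<^esub> u)"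

context complex_inner_product_space
begin

context
  fixes u
  assumes u: "u \<in> carrier H" "ip H u u = 1"
begin

lemma reflection_closed: "x \<in> carrier H \<Longrightarrow> reflection H u x \<in> carrier H"
  by (simp add: reflection_def u smult_closed')

lemma reflection_selfadjoint:
  "\<lbrakk>x \<in> carrier H; y \<in> carrier H\<rbrakk> \<Longrightarrow> ip H (reflection H u x) y = ip H x (reflection H u y)"
  using ip_cnj[of y u]
  by (simp add: reflection_def u smult_closed' ip_add ip_smult ip_add_right ip_smult_right)

lemma reflection_involution:
  assumes [simp]: "x \<in> carrier H"
  shows "reflection H u (reflection H u x) = x"
  by (rule ip_eqI)
    (simp_all add: reflection_def u smult_closed' ip_add ip_smult ip_add_right ip_smult_right algebra_simps)

text \<open>Everything comes from selfadjointness and involutivity: a map with a formal adjoint is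
  linear, and moving one reflection across the inner product cancels it against the other.\<close>

lemma reflection_isometry: "isometry H (reflection H u)"
proof -
  have "hnorm H (reflection H u x) = hnorm H x" if "x \<in> carrier H" for x
    using that by (simp add: hnorm_def reflection_selfadjoint reflection_closed reflection_involution)
  moreover have "reflection H u (x \<oplus> y) = reflection H u x \<oplus> reflection H u y"
    if "x \<in> carrier H" "y \<in> carrier H" for x y
    using that
    by (intro ip_eqI) (simp_all add: reflection_closed ip_add_right flip: reflection_selfadjoint)
  moreover have "reflection H u (c \<odot> x) = c \<odot> reflection H u x" if "x \<in> carrier H" for c x
    using that by (intro ip_eqI)
      (simp_all add: reflection_closed smult_closed' ip_smult_right flip: reflection_selfadjoint)
  moreover have "reflection H u \<in> carrier H \<rightarrow>\<^sub>E carrier H"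
    using reflection_closed by (auto simp: reflection_def)
  ultimately show ?thesis
    by (auto simp: isometry_def bounded_operators_def intro: exI[of _ 1])
qed

end

end

section \<open>The Hilbert space of square-summable sequences\<close>

definition l2 :: "(nat \<Rightarrow> complex) hilbert"
  where "l2 = \<lparr>carrier = {x. summable (\<lambda>n. (cmod (x n))\<^sup>2)},
    monoid.mult = undefined, one = undefined, ring.zero = (\<lambda>n. 0), add = (\<lambda>x y n. x n + y n),
    smult = (\<lambda>c x n. c * x n), ip = (\<lambda>x y. \<Sum>n. x n * cnj (y n))\<rparr>"

lemma l2_simps [simp]:
  "\<zero>\<^bsub>l2\<^esub> = (\<lambda>n. 0)"
  "x \<oplus>\<^bsub>l2\<^esub> y = (\<lambda>n. x n + y n)"
  "c \<odot>\<^bsub>l2\<^esub> x = (\<lambda>n. c * x n)"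
  by (simp_all add: l2_def)

lemma mem_l2: "x \<in> carrier l2 \<longleftrightarrow> summable (\<lambda>n. (cmod (x n))\<^sup>2)"
  by (simp add: l2_def)

lemma ip_l2: "ip l2 x y = (\<Sum>n. x n * cnj (y n))"
  by (simp add: l2_def)

lemma l2_comparison:
  assumes "x \<in> carrier l2" "\<And>n. cmod (y n) \<le> cmod (x n)"
  shows "y \<in> carrier l2"
  unfolding mem_l2
  by (rule summable_comparison_test'[of "\<lambda>n. (cmod (x n))\<^sup>2" 0])
    (use assms in \<open>auto simp: mem_l2 power_mono\<close>)

lemma l2_zero_closed: "(\<lambda>n. 0) \<in> carrier l2"
  by (simp add: mem_l2)

lemma l2_add_closed:
  assumes "x \<in> carrier l2" "y \<in> carrier l2"
  shows "(\<lambda>n. x n + y n) \<in> carrier l2"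
  unfolding mem_l2
proof (rule summable_comparison_test'[of _ 0])
  show "summable (\<lambda>n. 2 * (cmod (x n))\<^sup>2 + 2 * (cmod (y n))\<^sup>2)"
    using assms by (intro summable_add summable_mult) (auto simp: mem_l2)
  show "norm ((cmod (x n + y n))\<^sup>2) \<le> 2 * (cmod (x n))\<^sup>2 + 2 * (cmod (y n))\<^sup>2" for n
  proof -
    have "(cmod (x n + y n))\<^sup>2 \<le> (cmod (x n) + cmod (y n))\<^sup>2"
      by (rule power_mono) (simp_all add: norm_triangle_ineq)
    also have "\<dots> \<le> 2 * (cmod (x n))\<^sup>2 + 2 * (cmod (y n))\<^sup>2"
      using sum_squares_bound[of "cmod (x n)" "cmod (y n)"] by (simp add: power2_sum)
    finally show ?thesis by simp
  qed
qed

lemma l2_smult_closed: "x \<in> carrier l2 \<Longrightarrow> (\<lambda>n. c * x n) \<in> carrier l2"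
  using summable_mult[of "\<lambda>n. (cmod (x n))\<^sup>2" "(cmod c)\<^sup>2"]
  by (simp add: mem_l2 norm_mult power_mult_distrib)

lemma l2_uminus_closed: "x \<in> carrier l2 \<Longrightarrow> (\<lambda>n. - x n) \<in> carrier l2"
  by (simp add: mem_l2)

lemma l2_diff_closed: "\<lbrakk>x \<in> carrier l2; y \<in> carrier l2\<rbrakk> \<Longrightarrow> (\<lambda>n. x n - y n) \<in> carrier l2"
  using l2_add_closed[OF _ l2_uminus_closed, of x y] by simp

lemma l2_summable_ip:
  assumes "x \<in> carrier l2" "y \<in> carrier l2"
  shows "summable (\<lambda>n. x n * cnj (y n))"
proof (rule summable_comparison_test'[of _ 0])
  show "summable (\<lambda>n. (cmod (x n))\<^sup>2 + (cmod (y n))\<^sup>2)"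
    using assms by (intro summable_add) (auto simp: mem_l2)
  show "norm (x n * cnj (y n)) \<le> (cmod (x n))\<^sup>2 + (cmod (y n))\<^sup>2" for n
  proof -
    have "0 \<le> cmod (x n) * cmod (y n)"
      by simp
    then show ?thesis
      using sum_squares_bound[of "cmod (x n)" "cmod (y n)"]
      by (simp only: norm_mult complex_mod_cnj mult.assoc)
  qed
qed

lemma l2_ip_self: "x \<in> carrier l2 \<Longrightarrow> ip l2 x x = of_real (\<Sum>n. (cmod (x n))\<^sup>2)"
  unfolding ip_l2 mem_l2 by (subst suminf_of_real) (simp_all only: complex_norm_square)

interpretation l2: complex_inner_product_space l2
proof (intro complex_inner_product_space.intro complex_inner_product_space_axioms.intro moduleI)
  show "cring complex_ring" ..
  show "abelian_group l2"
  proof (rule abelian_groupI)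
    show "\<exists>y\<in>carrier l2. y \<oplus>\<^bsub>l2\<^esub> x = \<zero>\<^bsub>l2\<^esub>" if "x \<in> carrier l2" for x
      by (rule bexI[OF _ l2_uminus_closed[OF that]]) simp
  qed (simp_all add: l2_zero_closed l2_add_closed ac_simps)
  show "ip l2 (x \<oplus>\<^bsub>l2\<^esub> y) z = ip l2 x z + ip l2 y z"
    if "x \<in> carrier l2" "y \<in> carrier l2" "z \<in> carrier l2" for x y z
    using that by (simp add: ip_l2 distrib_right suminf_add l2_summable_ip)
  show "ip l2 (c \<odot>\<^bsub>l2\<^esub> x) y = c * ip l2 x y" if "x \<in> carrier l2" "y \<in> carrier l2" for c x y
    using that by (simp add: ip_l2 mult.assoc suminf_mult l2_summable_ip)
  show "ip l2 y x = cnj (ip l2 x y)" if "x \<in> carrier l2" "y \<in> carrier l2" for x y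
  proof -
    have "(\<lambda>n. cnj (x n * cnj (y n))) sums cnj (ip l2 x y)"
      unfolding ip_l2 sums_cnj by (rule summable_sums[OF l2_summable_ip[OF that]])
    then show ?thesis
      by (simp add: ip_l2 sums_iff ac_simps)
  qed
  show "0 < Re (ip l2 x x)" if x: "x \<in> carrier l2" and nz: "x \<noteq> \<zero>\<^bsub>l2\<^esub>" for x
  proof -
    obtain n where "x n \<noteq> 0"
      using nz by auto
    then have "0 < (\<Sum>n. (cmod (x n))\<^sup>2)"
      using x by (intro suminf_pos2[of _ n]) (auto simp: mem_l2)
    then show ?thesis
      using x by (simp add: l2_ip_self)
  qed
qed (auto simp: ring_of_type_algebra_def l2_smult_closed algebra_simps)

lemma l2_uminus: "x \<in> carrier l2 \<Longrightarrow> \<ominus>\<^bsub>l2\<^esub> x = (\<lambda>n. - x n)"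
  by (rule l2.M.minus_equality) (simp_all add: l2_uminus_closed)

lemma hdist_l2: "\<lbrakk>x \<in> carrier l2; y \<in> carrier l2\<rbrakk> \<Longrightarrow> hdist l2 x y = hnorm l2 (\<lambda>n. x n - y n)"
  by (simp add: hdist_def a_minus_def l2_uminus)

lemma hnorm_l2: "x \<in> carrier l2 \<Longrightarrow> (hnorm l2 x)\<^sup>2 = (\<Sum>n. (cmod (x n))\<^sup>2)"
  by (simp add: l2.hnorm_sq l2_ip_self)

lemma sum_le_hnorm_l2: "x \<in> carrier l2 \<Longrightarrow> (\<Sum>n<N. (cmod (x n))\<^sup>2) \<le> (hnorm l2 x)\<^sup>2"
  by (simp add: hnorm_l2 mem_l2 sum_le_suminf)

lemma cmod_le_hnorm_l2:
  assumes "x \<in> carrier l2"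
  shows "cmod (x n) \<le> hnorm l2 x"
proof (rule power2_le_imp_le)
  have "(cmod (x n))\<^sup>2 \<le> (\<Sum>k<Suc n. (cmod (x k))\<^sup>2)"
    by (simp add: sum_nonneg)
  also have "\<dots> \<le> (hnorm l2 x)\<^sup>2"
    by (rule sum_le_hnorm_l2[OF assms])
  finally show "(cmod (x n))\<^sup>2 \<le> (hnorm l2 x)\<^sup>2" .
qed (simp add: l2.hnorm_nonneg assms)

text \<open>Bounds on finite partial sums survive coordinatewise limits; the completeness proof uses
  them in this form.\<close>

lemma l2_boundedI:
  assumes "\<And>N. (\<Sum>n<N. (cmod (x n))\<^sup>2) \<le> c\<^sup>2" "0 \<le> c"
  shows "x \<in> carrier l2" "hnorm l2 x \<le> c"
proof -
  show x: "x \<in> carrier l2"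
    unfolding mem_l2 by (rule summableI_nonneg_bounded[OF _ assms(1)]) simp
  have "(hnorm l2 x)\<^sup>2 \<le> c\<^sup>2"
    unfolding hnorm_l2[OF x] by (rule suminf_le_const) (use x assms in \<open>auto simp: mem_l2\<close>)
  then show "hnorm l2 x \<le> c"
    using assms(2) by (rule power2_le_imp_le)
qed

lemma hnorm_l2_mono:
  assumes x: "x \<in> carrier l2" and le: "\<And>n. cmod (y n) \<le> cmod (x n)"
  shows "hnorm l2 y \<le> hnorm l2 x"
proof (rule l2_boundedI(2))
  show "(\<Sum>n<N. (cmod (y n))\<^sup>2) \<le> (hnorm l2 x)\<^sup>2" for N
    by (rule order_trans[OF sum_mono sum_le_hnorm_l2[OF x]]) (simp add: le power_mono)
qed (simp add: x l2.hnorm_nonneg)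

text \<open>Each coordinate is dominated by the norm, so a Cauchy sequence converges coordinatewise.
  The Cauchy estimate, restricted to finitely many coordinates and passed to the limit, shows that
  convergence to the coordinatewise limit also holds in norm.\<close>

lemma complex_hilbert_space_l2: "complex_hilbert_space l2"
proof
  show "l2.metric.mcomplete"
    unfolding l2.metric.mcomplete_def
  proof (intro allI impI)
    fix \<sigma> assume "l2.metric.MCauchy \<sigma>"
    then have \<sigma>: "\<sigma> n \<in> carrier l2"
      and Cauchy: "e > 0 \<Longrightarrow> \<exists>N. \<forall>n\<ge>N. \<forall>m\<ge>N. hnorm l2 (\<lambda>k. \<sigma> n k - \<sigma> m k) < e" for n e
      by (fastforce simp: l2.metric.MCauchy_def image_subset_iff hdist_l2)+
    have "\<exists>l. (\<lambda>n. \<sigma> n k) \<longlonglongrightarrow> l" for k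
    proof (rule Cauchy_convergent[unfolded convergent_def], rule metric_CauchyI)
      fix e :: real assume "e > 0"
      with Cauchy obtain N where N: "\<forall>n\<ge>N. \<forall>m\<ge>N. hnorm l2 (\<lambda>k. \<sigma> n k - \<sigma> m k) < e"
        by blast
      show "\<exists>N. \<forall>m\<ge>N. \<forall>n\<ge>N. dist (\<sigma> m k) (\<sigma> n k) < e"
        using N by (intro exI[of _ N])
          (auto simp: dist_norm intro: le_less_trans[OF cmod_le_hnorm_l2[OF l2_diff_closed[OF \<sigma> \<sigma>]]])
    qed
    then obtain x where x: "\<And>k. (\<lambda>n. \<sigma> n k) \<longlonglongrightarrow> x k"
      by metis
    have bound: "(\<lambda>k. \<sigma> n k - x k) \<in> carrier l2 \<and> hnorm l2 (\<lambda>k. \<sigma> n k - x k) \<le> e"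
      if N: "\<forall>n\<ge>N. \<forall>m\<ge>N. hnorm l2 (\<lambda>k. \<sigma> n k - \<sigma> m k) < e" and e: "e > 0" and n: "n \<ge> N"
      for N n e
    proof -
      \<comment> \<open>With \<open>n\<close> and \<open>K\<close> fixed, \<open>m\<close> tends to
        infinity. Only finitely many coordinates occur, so the limit can be taken termwise; the
        strict bound becomes a weak one.\<close>
      have "(\<Sum>k<K. (cmod (\<sigma> n k - x k))\<^sup>2) \<le> e\<^sup>2" for K
      proof (rule Lim_bounded)
        show "(\<lambda>m. \<Sum>k<K. (cmod (\<sigma> n k - \<sigma> m k))\<^sup>2) \<longlonglongrightarrow> (\<Sum>k<K. (cmod (\<sigma> n k - x k))\<^sup>2)"
          by (intro tendsto_intros x)
        show "\<forall>m\<ge>N. (\<Sum>k<K. (cmod (\<sigma> n k - \<sigma> m k))\<^sup>2) \<le> e\<^sup>2"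
        proof (intro allI impI)
          fix m assume "m \<ge> N"
          then have "(hnorm l2 (\<lambda>k. \<sigma> n k - \<sigma> m k))\<^sup>2 \<le> e\<^sup>2"
            using N n by (intro power_mono) (auto simp: l2.hnorm_nonneg l2_diff_closed \<sigma> less_imp_le)
          then show "(\<Sum>k<K. (cmod (\<sigma> n k - \<sigma> m k))\<^sup>2) \<le> e\<^sup>2"
            using sum_le_hnorm_l2[OF l2_diff_closed[OF \<sigma> \<sigma>]] by (rule order_trans[rotated])
        qed
      qed
      then show ?thesis
        using l2_boundedI[of "\<lambda>k. \<sigma> n k - x k" e] e by auto
    qed
    obtain N where N: "\<forall>n\<ge>N. \<forall>m\<ge>N. hnorm l2 (\<lambda>k. \<sigma> n k - \<sigma> m k) < 1"
      using Cauchy[of 1] by auto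
    \<comment> \<open>The limit is \<open>\<sigma> N\<close> minus the square-summable difference
      supplied by \<open>bound\<close>.\<close>
    have [simp]: "x \<in> carrier l2"
      using l2_diff_closed[OF \<sigma>[of N], of "\<lambda>k. \<sigma> N k - x k"] bound[OF N, of N] by simp
    show "\<exists>x. limitin l2.metric.mtopology \<sigma> x sequentially"
    proof (intro exI, unfold l2.metric.limit_metric_sequentially, intro conjI allI impI)
      fix e :: real assume "e > 0"
      \<comment> \<open>Since \<open>bound\<close> yields only a weak inequality,
        \<open>e / 2\<close> is used to end with a strict one.\<close>
      then obtain N where N: "\<forall>n\<ge>N. \<forall>m\<ge>N. hnorm l2 (\<lambda>k. \<sigma> n k - \<sigma> m k) < e / 2"
        using Cauchy[of "e / 2"] by auto
      show "\<exists>N. \<forall>n\<ge>N. \<sigma> n \<in> carrier l2 \<and> hdist l2 (\<sigma> n) x < e"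
        using bound[OF N] \<open>e > 0\<close> by (intro exI[of _ N]) (fastforce simp: hdist_l2 \<sigma>)
    qed simp
  qed
qed

section \<open>Standard basis, approximation by finitely supported sequences, separability\<close>

definition unit_seq :: "nat \<Rightarrow> nat \<Rightarrow> complex"
  where "unit_seq m = (\<lambda>n. if n = m then 1 else 0)"

lemma finite_support_l2:
  assumes "\<And>n. n \<ge> N \<Longrightarrow> x n = 0"
  shows "x \<in> carrier l2" "(hnorm l2 x)\<^sup>2 = (\<Sum>n<N. (cmod (x n))\<^sup>2)"
proof -
  show x: "x \<in> carrier l2"
    unfolding mem_l2 by (rule summable_finite[of "{..<N}"]) (use assms in auto)
  show "(hnorm l2 x)\<^sup>2 = (\<Sum>n<N. (cmod (x n))\<^sup>2)"
    unfolding hnorm_l2[OF x] by (rule suminf_finite) (use assms in auto)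
qed

lemma unit_seq_l2 [simp]: "unit_seq m \<in> carrier l2"
  by (rule finite_support_l2(1)[of "Suc m"]) (auto simp: unit_seq_def)

lemma ip_unit_seq: "ip l2 x (unit_seq m) = x m"
  unfolding ip_l2 by (subst suminf_finite[of "{m}"]) (auto simp: unit_seq_def)

lemma ip_unit_seq_self: "ip l2 (unit_seq m) (unit_seq m) = 1"
  by (simp add: ip_unit_seq) (simp add: unit_seq_def)

lemma l2_tail:
  assumes x: "x \<in> carrier l2" and e: "e > 0"
  obtains N where "hnorm l2 (\<lambda>n. if n < N then 0 else x n) < e"
proof -
  have "summable (\<lambda>n. (cmod (x n))\<^sup>2)"
    using x by (simp add: mem_l2)
  then obtain N where N: "norm (\<Sum>i. (cmod (x (i + N)))\<^sup>2) < e\<^sup>2"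
    using suminf_exist_split[of "e\<^sup>2" "\<lambda>n. (cmod (x n))\<^sup>2"] e by auto
  define y where "y = (\<lambda>n. if n < N then 0 else x n)"
  have y: "y \<in> carrier l2"
    by (rule l2_comparison[OF x]) (auto simp: y_def)
  have "(hnorm l2 y)\<^sup>2 = (\<Sum>i. (cmod (y (i + N)))\<^sup>2)"
    unfolding hnorm_l2[OF y]
    by (subst suminf_split_initial_segment[of _ N]) (use y in \<open>auto simp: mem_l2 y_def\<close>)
  also have "\<dots> < e\<^sup>2"
    using N by (simp add: y_def)
  finally have "hnorm l2 y < e"
    using e by (intro power2_less_imp_less[of _ e]) auto
  then show thesis
    using that by (simp add: y_def)
qed

text \<open>The dense set consists of finitely supported sequences with entries in a countable dense
  set of complex numbers. The approximation error splits into \<open>u\<close> on the first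
  \<open>N\<close> coordinates and the tail \<open>v\<close>, each contributing at most
  \<open>e / 2\<close>, the tail strictly less.\<close>

lemma separable_l2: "separable_space (htopology l2)"
proof -
  obtain D :: "complex set" where D: "countable D" "\<And>U. \<lbrakk>open U; U \<noteq> {}\<rbrakk> \<Longrightarrow> \<exists>d\<in>D. d \<in> U"
    using countable_dense_setE by blast
  define C where "C = (\<lambda>l n. if n < length l then l ! n else 0) ` lists D"
  have "countable C"
    unfolding C_def using D(1) by (intro countable_image countable_lists)
  moreover have "(\<lambda>n. if n < length l then l ! n else 0) \<in> carrier l2" for l
    by (rule finite_support_l2(1)[of "length l"]) simp
  then have C: "C \<subseteq> carrier l2"
    unfolding C_def by blast
  moreover have "\<exists>y\<in>C. y \<in> l2.metric.mball x e" if x: "x \<in> carrier l2" and e: "e > 0" for x e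
  proof -
    obtain N where N: "hnorm l2 (\<lambda>n. if n < N then 0 else x n) < e / 2"
      using l2_tail[OF x, of "e / 2"] e by auto
    \<comment> \<open>Adding 1 keeps \<open>c\<close> positive when \<open>N = 0\<close>. With
      precision \<open>\<delta>\<close> per coordinate, the squared error on the first
      \<open>N\<close> coordinates is at most \<open>N\<close> times the square of
      \<open>\<delta>\<close>, hence at most the square of
      \<open>c * \<delta> = e / 2\<close>.\<close>
    define c where "c = real N + 1"
    have c: "c > 0" "real N \<le> c\<^sup>2"
      using self_le_power[of c 2] by (simp_all add: c_def)
    define \<delta> where "\<delta> = e / 2 / c"
    have "\<delta> > 0" and \<delta>: "c * \<delta> = e / 2"
      using e c(1) by (simp_all add: \<delta>_def)
    then have "\<exists>d\<in>D. d \<in> ball (x n) \<delta>" for n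
      by (intro D(2)) auto
    then obtain d where d: "\<And>n. d n \<in> D" "\<And>n. cmod (x n - d n) < \<delta>"
      unfolding mem_ball dist_norm by metis
    define y where "y = (\<lambda>n. if n < N then d n else 0)"
    have "y = (\<lambda>n. if n < length (map d [0..<N]) then map d [0..<N] ! n else 0)"
      by (auto simp: y_def)
    moreover have "map d [0..<N] \<in> lists D"
      using d(1) by auto
    ultimately have "y \<in> C"
      unfolding C_def by blast
    define u where "u = (\<lambda>n. if n < N then x n - d n else 0)"
    define v where "v = (\<lambda>n. if n < N then 0 else x n)"
    have "u n = 0" if "n \<ge> N" for n
      using that by (simp add: u_def)
    then have u: "u \<in> carrier l2" "(hnorm l2 u)\<^sup>2 = (\<Sum>n<N. (cmod (u n))\<^sup>2)"
      using finite_support_l2[of N u] by blast+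
    have v: "v \<in> carrier l2"
      by (rule l2_comparison[OF x]) (auto simp: v_def)
    have "(\<Sum>n<N. (cmod (u n))\<^sup>2) \<le> of_nat (card {..<N}) * \<delta>\<^sup>2"
      by (rule sum_bounded_above) (simp add: u_def power_mono[OF less_imp_le[OF d(2)]])
    also have "\<dots> \<le> c\<^sup>2 * \<delta>\<^sup>2"
      by (rule mult_right_mono) (simp_all add: c(2))
    also have "\<dots> = (e / 2)\<^sup>2"
      unfolding power_mult_distrib [symmetric] \<delta> ..
    finally have "(hnorm l2 u)\<^sup>2 \<le> (e / 2)\<^sup>2"
      unfolding u(2) .
    then have "hnorm l2 u \<le> e / 2"
      by (rule power2_le_imp_le) (use e in simp)
    then have "hnorm l2 (\<lambda>n. u n + v n) < e"
      using l2.hnorm_triangle[OF u(1) v] N by (simp add: v_def)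
    moreover have "(\<lambda>n. u n + v n) = (\<lambda>n. x n - y n)"
      by (auto simp: u_def v_def y_def)
    ultimately have "hdist l2 x y < e"
      using \<open>y \<in> C\<close> C x by (simp add: hdist_l2 subset_iff)
    then show ?thesis
      using \<open>y \<in> C\<close> C x by (intro bexI[of _ y]) (auto simp: l2.metric.in_mball)
  qed
  ultimately show ?thesis
    unfolding separable_space_def
    by (intro exI[of _ C]) (auto simp: l2.metric.metric_closure_of)
qed

text \<open>Every truncation of a sequence is a finite combination of basis vectors, and truncations
  of a square-summable sequence converge to it in norm.\<close>

lemma closed_subspace_all_unit_seq:
  assumes M: "closed_subspace l2 M" and unit: "\<And>n. unit_seq n \<in> M"
  shows "M = carrier l2"
proof -
  have sub: "submodule M complex_ring l2" and closed: "closedin l2.metric.mtopology M"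
    using M by (auto simp: closed_subspace_def)
  have "M \<subseteq> carrier l2"
    using l2.submoduleE(1)[OF sub] .
  have trunc: "(\<lambda>n. if n < N then x n else 0) \<in> M" for x N
  proof (induction N)
    case 0
    then show ?case
      using subgroup.one_closed[OF submodule.axioms(1)[OF sub]] by simp
  next
    case (Suc N)
    have "x N \<odot>\<^bsub>l2\<^esub> unit_seq N \<in> M"
      using submodule.smult_closed[OF sub _ unit] by (simp add: ring_of_type_algebra_def)
    from l2.submoduleE(5)[OF sub Suc this]
    have "(\<lambda>n. (if n < N then x n else 0) + x N * unit_seq N n) \<in> M"
      by simp
    also have "(\<lambda>n. (if n < N then x n else 0) + x N * unit_seq N n)
        = (\<lambda>n. if n < Suc N then x n else 0)"
      by (auto simp: unit_seq_def less_Suc_eq)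
    finally show ?case .
  qed
  have "x \<in> M" if x: "x \<in> carrier l2" for x
  proof -
    have "\<exists>y\<in>M. y \<in> l2.metric.mball x e" if "e > 0" for e
    proof -
      obtain N where N: "hnorm l2 (\<lambda>n. if n < N then 0 else x n) < e"
        using l2_tail[OF x \<open>e > 0\<close>] by auto
      define y where "y = (\<lambda>n. if n < N then x n else 0)"
      have "y \<in> M"
        unfolding y_def by (rule trunc)
      moreover have "(\<lambda>n. x n - y n) = (\<lambda>n. if n < N then 0 else x n)"
        by (auto simp: y_def)
      ultimately show ?thesis
        using N x \<open>M \<subseteq> carrier l2\<close>
        by (intro bexI[of _ y]) (auto simp: l2.metric.in_mball hdist_l2)
    qed
    then have "x \<in> l2.metric.mtopology closure_of M"
      using x by (simp add: l2.metric.metric_closure_of)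
    then show ?thesis
      using closed by (simp add: closure_of_closedin)
  qed
  then show ?thesis
    using \<open>M \<subseteq> carrier l2\<close> by blast
qed

section \<open>Infinite dimension, by linear algebra in the space of all sequences\<close>

interpretation seq: vector_space "\<lambda>c (x :: nat \<Rightarrow> complex) n. c * x n"
  by standard (auto simp: algebra_simps)

text \<open>Coordinate \<open>m\<close> vanishes on the span of all the other basis vectors.\<close>

lemma independent_unit_seq: "seq.independent (range unit_seq)"
proof
  assume "seq.dependent (range unit_seq)"
  then obtain m where m: "unit_seq m \<in> seq.span (range unit_seq - {unit_seq m})"
    by (auto simp: seq.dependent_def)
  have "seq.span (range unit_seq - {unit_seq m}) \<subseteq> {x. x m = 0}"
    by (rule seq.span_minimal) (auto simp: unit_seq_def seq.subspace_def)
  then show False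
    using m by (auto simp: unit_seq_def)
qed

text \<open>The submodule hull of \<open>B\<close> lies in the linear span of \<open>B\<close>. A
  finite generating set would thus span the infinite independent family of basis vectors.\<close>

lemma infinite_dimensional_l2: "infinite_dimensional l2"
  unfolding infinite_dimensional_def
proof
  assume "\<exists>B. finite B \<and> B \<subseteq> carrier l2 \<and>
    (\<lambda>M. submodule M complex_ring l2) hull B = carrier l2"
  then obtain B where B: "finite B" "B \<subseteq> carrier l2"
    and hull: "(\<lambda>M. submodule M complex_ring l2) hull B = carrier l2"
    by blast
  \<comment> \<open>The span is formed among all sequences; the intersection places it inside
    \<open>carrier l2\<close>, as a submodule must be.\<close>
  have "submodule (seq.span B \<inter> carrier l2) complex_ring l2"
  proof (rule l2.submoduleI)
    fix x y assume xy: "x \<in> seq.span B \<inter> carrier l2" "y \<in> seq.span B \<inter> carrier l2"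
    show "x \<oplus>\<^bsub>l2\<^esub> y \<in> seq.span B \<inter> carrier l2"
      using xy seq.span_add[of x B y] by (simp add: l2_add_closed plus_fun_def)
  next
    fix x assume x: "x \<in> seq.span B \<inter> carrier l2"
    show "a \<odot>\<^bsub>l2\<^esub> x \<in> seq.span B \<inter> carrier l2" for a
      using x seq.span_scale[of x B a] by (simp add: l2_smult_closed)
    show "\<ominus>\<^bsub>l2\<^esub> x \<in> seq.span B \<inter> carrier l2"
      using x seq.span_scale[of x B "-1"] by (simp add: l2_uminus l2_uminus_closed)
  qed (use seq.span_zero[of B] in \<open>auto simp: l2_zero_closed zero_fun_def\<close>)
  then have "carrier l2 \<subseteq> seq.span B"
    using hull_minimal[of B "seq.span B \<inter> carrier l2" "\<lambda>M. submodule M complex_ring l2"]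
      B(2) seq.span_superset[of B] hull by blast
  then have "range unit_seq \<subseteq> seq.span B"
    by auto
  then have "finite (range unit_seq)"
    using seq.independent_span_bound[OF B(1) independent_unit_seq] by blast
  moreover have "inj unit_seq"
    by (rule injI) (auto simp: unit_seq_def fun_eq_iff split: if_splits)
  ultimately show False
    using finite_imageD infinite_UNIV_nat by blast
qed

section \<open>Isometries respecting the block structure\<close>

definition block :: "nat \<Rightarrow> nat"
  where "block n = fst (prod_decode n)"

definition block_space :: "nat set \<Rightarrow> (nat \<Rightarrow> complex) set"
  where "block_space A = {x \<in> carrier l2. \<forall>n. block n \<notin> A \<longrightarrow> x n = 0}"

definition block_proj :: "nat set \<Rightarrow> (nat \<Rightarrow> complex) \<Rightarrow> nat \<Rightarrow> complex"
  where "block_proj A = (\<lambda>x\<in>carrier l2. \<lambda>n. if block n \<in> A then x n else 0)"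

text \<open>The case \<open>A = UNIV\<close> controls the range of \<open>V\<close>; asking the same
  for every \<open>A\<close> makes the condition stable under composition.\<close>

definition block_isometries :: "((nat \<Rightarrow> complex) \<Rightarrow> nat \<Rightarrow> complex) set"
  where "block_isometries = {V. isometry l2 V \<and> (\<forall>A. \<exists>B. V ` block_space A = block_space B)}"

lemma block_space_UNIV: "block_space UNIV = carrier l2"
  by (auto simp: block_space_def)

lemma block_proj_UNIV: "block_proj UNIV = id_op l2"
  by (auto simp: block_proj_def id_op_def)

lemma block_proj_closed: "x \<in> carrier l2 \<Longrightarrow> block_proj A x \<in> carrier l2"
  by (rule l2_comparison[of x]) (auto simp: block_proj_def)

lemma block_proj_mem: "block_proj A \<in> carrier l2 \<rightarrow>\<^sub>E block_space A"
  using block_proj_closed by (auto simp: block_space_def block_proj_def)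

lemma block_proj_id: "x \<in> block_space A \<Longrightarrow> block_proj A x = x"
  by (auto simp: block_space_def block_proj_def)

lemma ip_block_proj:
  "\<lbrakk>x \<in> carrier l2; y \<in> carrier l2\<rbrakk> \<Longrightarrow> ip l2 (block_proj A x) y = ip l2 x (block_proj A y)"
  unfolding ip_l2 by (rule arg_cong[of _ _ suminf]) (auto simp: block_proj_def)

lemma block_proj_compose:
  "compose (carrier l2) (block_proj A) (block_proj B) = block_proj (A \<inter> B)"
proof (rule extensionalityI[of _ "carrier l2"])
  show "compose (carrier l2) (block_proj A) (block_proj B) x = block_proj (A \<inter> B) x"
    if "x \<in> carrier l2" for x
    using that block_proj_closed[OF that, of B] by (auto simp: compose_eq block_proj_def)
qed (simp_all add: block_proj_def)

lemma orthogonal_projection_block_proj: "orthogonal_projection l2 (block_proj A)"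
proof -
  have mem: "block_proj A \<in> carrier l2 \<rightarrow>\<^sub>E carrier l2"
    using block_proj_closed by (auto simp: PiE_def Pi_def extensional_def) (simp add: block_proj_def)
  have bounded: "block_proj A \<in> bounded_operators l2"
    unfolding bounded_operators_def mem_Collect_eq
  proof (intro conjI ballI allI exI[of _ "1 :: real"])
    show "hnorm l2 (block_proj A x) \<le> 1 * hnorm l2 x" if "x \<in> carrier l2" for x
      using hnorm_l2_mono[OF that, of "block_proj A x"] that by (simp add: block_proj_def)
  qed (rule mem, auto simp: block_proj_def l2_add_closed l2_smult_closed)
  then have "adj l2 (block_proj A) = block_proj A"
    by (rule l2.adjI(2)[OF _ mem ip_block_proj])
  with bounded show ?thesis
    by (simp add: orthogonal_projection_def block_proj_compose)
qed

text \<open>The range of \<open>V\<close> is some \<open>block_space A\<close>, so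
  \<open>block_proj A\<close> can serve as the projection in \<open>isometry_adj\<close>: it is
  selfadjoint and fixes every \<open>V x\<close>.\<close>

lemma block_isometry_adj:
  assumes "V \<in> block_isometries"
  shows "\<And>x y. \<lbrakk>x \<in> carrier l2; y \<in> carrier l2\<rbrakk> \<Longrightarrow> ip l2 (V x) y = ip l2 x (adj l2 V y)"
    and "init_proj l2 V = id_op l2" and "\<exists>A. range_proj l2 V = block_proj A"
proof -
  have V: "isometry l2 V"
    using assms by (simp add: block_isometries_def)
  obtain A where "V ` block_space UNIV = block_space A"
    using assms unfolding block_isometries_def by blast
  then have A: "V ` carrier l2 = block_space A"
    by (simp add: block_space_UNIV)
  have ip_proj: "ip l2 (V x) (block_proj A y) = ip l2 (V x) y" if "x \<in> carrier l2" "y \<in> carrier l2" for x y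
  proof -
    have "V x \<in> block_space A"
      using A that by blast
    then have "ip l2 (V x) (block_proj A y) = ip l2 (block_proj A (V x)) y"
      using that by (subst ip_block_proj) (auto simp: block_space_def)
    then show ?thesis
      using \<open>V x \<in> block_space A\<close> by (simp add: block_proj_id)
  qed
  have E: "block_proj A \<in> carrier l2 \<rightarrow>\<^sub>E V ` carrier l2"
    unfolding A by (rule block_proj_mem)
  show "ip l2 (V x) y = ip l2 x (adj l2 V y)" if "x \<in> carrier l2" "y \<in> carrier l2" for x y
    by (rule l2.isometry_adj(1)[OF V E ip_proj that])
  show "init_proj l2 V = id_op l2"
    by (rule l2.isometry_adj(2)[OF V E ip_proj])
  have "range_proj l2 V = block_proj A"
    by (rule l2.isometry_adj(3)[OF V E ip_proj])
  then show "\<exists>A. range_proj l2 V = block_proj A" ..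
qed

lemma id_block_isometry: "id_op l2 \<in> block_isometries"
proof -
  have "id_op l2 ` block_space A = block_space A" for A
    by (auto simp: id_op_def block_space_def image_iff)
  then show ?thesis
    by (auto simp: block_isometries_def l2.isometry_id)
qed

lemma block_isometries_semigroup: "operator_semigroup l2 block_isometries"
  unfolding operator_semigroup_def
proof (intro conjI ballI)
  show "block_isometries \<noteq> {}"
    using id_block_isometry by blast
  show "block_isometries \<subseteq> bounded_operators l2"
    by (auto simp: block_isometries_def isometry_def)
  fix V W assume VW: "V \<in> block_isometries" "W \<in> block_isometries"
  have "\<exists>C. compose (carrier l2) V W ` block_space A = block_space C" for A
  proof -
    have "compose (carrier l2) V W ` block_space A = V ` W ` block_space A"
      by (auto simp: compose_def block_space_def image_iff)
    moreover obtain B where "W ` block_space A = block_space B"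
      using VW(2) unfolding block_isometries_def by blast
    moreover obtain C where "V ` block_space B = block_space C"
      using VW(1) unfolding block_isometries_def by blast
    ultimately show ?thesis by auto
  qed
  then show "compose (carrier l2) V W \<in> block_isometries"
    using VW by (simp add: block_isometries_def l2.isometry_compose)
qed

text \<open>The initial projections are the identity, that is \<open>block_proj UNIV\<close>. All
  projections in question are thus of the form \<open>block_proj A\<close>, and products of these
  correspond to intersections of index sets.\<close>

lemma block_isometries_commuting:
  "commuting_projections l2 (init_proj l2 ` block_isometries \<union> range_proj l2 ` block_isometries)"
proof -
  have E: "\<exists>A. E = block_proj A"
    if "E \<in> init_proj l2 ` block_isometries \<union> range_proj l2 ` block_isometries" for E
    using that block_isometry_adj(2,3) block_proj_UNIV by (metis Un_iff imageE)
  show ?thesis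
    unfolding commuting_projections_def
  proof (intro conjI ballI)
    fix E F
    assume "E \<in> init_proj l2 ` block_isometries \<union> range_proj l2 ` block_isometries"
      and "F \<in> init_proj l2 ` block_isometries \<union> range_proj l2 ` block_isometries"
    then obtain A B where "E = block_proj A" "F = block_proj B"
      using E by meson
    then show "orthogonal_projection l2 E" "compose (carrier l2) E F = compose (carrier l2) F E"
      by (simp_all add: orthogonal_projection_block_proj block_proj_compose Int_commute)
  qed
qed

text \<open>If \<open>a \<notin> A\<close>, then \<open>u\<close> is orthogonal to
  \<open>block_space A\<close> and the reflection fixes that space pointwise. If
  \<open>a \<in> A\<close>, then \<open>u\<close> lies in it and only multiples of \<open>u\<close>
  are added. Involutivity upgrades the resulting inclusion to equality.\<close>

lemma reflection_block_isometry:
  assumes u: "u \<in> block_space {a}" "ip l2 u u = 1"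
  shows "reflection l2 u \<in> block_isometries"
proof -
  have u': "u \<in> carrier l2"
    using u by (simp add: block_space_def)
  have sub: "reflection l2 u ` block_space A \<subseteq> block_space A" for A
  proof
    fix y assume "y \<in> reflection l2 u ` block_space A"
    then obtain x where x: "x \<in> block_space A" "y = reflection l2 u x"
      by blast
    then have x': "x \<in> carrier l2"
      by (simp add: block_space_def)
    have y: "y = (\<lambda>n. x n + (- 2 * ip l2 x u) * u n)"
      using x' x by (simp add: reflection_def)
    have "ip l2 x u = 0" if "a \<notin> A"
    proof -
      have "(\<lambda>n. x n * cnj (u n)) = (\<lambda>n. 0)"
        using x(1) u(1) that by (force simp: block_space_def)
      then show ?thesis
        by (simp add: ip_l2)
    qed
    moreover have "x n = 0" if "block n \<notin> A" for n
      using that x(1) by (simp add: block_space_def)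
    moreover have "u n = 0" if "block n \<notin> A" "a \<in> A" for n
      using that u(1) by (auto simp: block_space_def)
    ultimately have "y n = 0" if "block n \<notin> A" for n
      unfolding y using that by (cases "a \<in> A") simp_all
    moreover have "y \<in> carrier l2"
      unfolding x(2) by (rule l2.reflection_closed[OF u' u(2) x'])
    ultimately show "y \<in> block_space A"
      by (simp add: block_space_def)
  qed
  have "block_space A \<subseteq> reflection l2 u ` block_space A" for A
  proof
    fix x assume x: "x \<in> block_space A"
    then have "x \<in> carrier l2"
      by (simp add: block_space_def)
    then show "x \<in> reflection l2 u ` block_space A"
      using l2.reflection_involution[OF u' u(2), of x] sub[of A] x by (metis image_subset_iff rev_image_eqI)
  qed
  with sub show ?thesis
    using l2.reflection_isometry[OF u' u(2)] unfolding block_isometries_def by blast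
qed

section \<open>Isometries that send the basis vector of index \<open>m\<close> to that of index
  \<open>v m\<close>\<close>

definition transport :: "(nat \<Rightarrow> nat) \<Rightarrow> (nat \<Rightarrow> complex) \<Rightarrow> nat \<Rightarrow> complex"
  where "transport v = (\<lambda>x\<in>carrier l2. \<lambda>n. if n \<in> range v then x (inv_into UNIV v n) else 0)"

text \<open>The injection may change the order of the terms; nonnegativity allows a passage through
  unordered sums, where order is irrelevant.\<close>

lemma sums_reindex_inj:
  fixes f :: "nat \<Rightarrow> real"
  assumes "inj v" "\<And>n. f n \<ge> 0" "\<And>n. n \<notin> range v \<Longrightarrow> f n = 0"
  shows "(\<lambda>m. f (v m)) sums s \<longleftrightarrow> f sums s"
proof -
  have "(\<lambda>m. f (v m)) sums s \<longleftrightarrow> ((f \<circ> v) has_sum s) UNIV"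
    using assms(2) by (auto simp: o_def intro: sums_nonneg_imp_has_sum has_sum_imp_sums)
  also have "\<dots> \<longleftrightarrow> (f has_sum s) (range v)"
    using assms(1) by (simp add: has_sum_reindex)
  also have "\<dots> \<longleftrightarrow> (f has_sum s) UNIV"
    by (rule has_sum_cong_neutral) (use assms(3) in auto)
  also have "\<dots> \<longleftrightarrow> f sums s"
    using assms(2) by (auto intro: sums_nonneg_imp_has_sum has_sum_imp_sums)
  finally show ?thesis .
qed

lemma l2_reindex_inj:
  assumes v: "inj v" and y: "\<And>n. n \<notin> range v \<Longrightarrow> y n = 0"
  shows "(\<lambda>m. y (v m)) \<in> carrier l2 \<longleftrightarrow> y \<in> carrier l2"
    and "y \<in> carrier l2 \<Longrightarrow> hnorm l2 (\<lambda>m. y (v m)) = hnorm l2 y"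
proof -
  have sums: "(\<lambda>m. (cmod (y (v m)))\<^sup>2) sums s \<longleftrightarrow> (\<lambda>n. (cmod (y n))\<^sup>2) sums s" for s
    by (rule sums_reindex_inj[OF v]) (simp_all add: y)
  show mem: "(\<lambda>m. y (v m)) \<in> carrier l2 \<longleftrightarrow> y \<in> carrier l2"
    unfolding mem_l2 summable_def sums ..
  assume "y \<in> carrier l2"
  then have "(hnorm l2 (\<lambda>m. y (v m)))\<^sup>2 = (hnorm l2 y)\<^sup>2"
    using mem by (simp add: hnorm_l2 suminf_def sums)
  then show "hnorm l2 (\<lambda>m. y (v m)) = hnorm l2 y"
    using \<open>y \<in> carrier l2\<close> mem by (simp add: power2_eq_iff_nonneg l2.hnorm_nonneg)
qed

context
  fixes v :: "nat \<Rightarrow> nat"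
  assumes v: "inj v"
begin

lemma transport_apply: "x \<in> carrier l2 \<Longrightarrow> transport v x (v m) = x m"
  by (simp add: transport_def v)

lemma transport_outside: "\<lbrakk>x \<in> carrier l2; n \<notin> range v\<rbrakk> \<Longrightarrow> transport v x n = 0"
  by (simp add: transport_def)

lemma transport_closed: "x \<in> carrier l2 \<Longrightarrow> transport v x \<in> carrier l2"
  using l2_reindex_inj(1)[OF v, of "transport v x"] by (simp add: transport_apply transport_outside)

lemma transport_isometry: "isometry l2 (transport v)"
proof -
  have "hnorm l2 (transport v x) = hnorm l2 x" if "x \<in> carrier l2" for x
    using l2_reindex_inj(2)[OF v, of "transport v x"] that
    by (simp add: transport_apply transport_outside transport_closed)
  moreover have "transport v \<in> carrier l2 \<rightarrow>\<^sub>E carrier l2"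
    using transport_closed by (auto simp: transport_def)
  ultimately show ?thesis
    by (auto simp: isometry_def bounded_operators_def transport_def l2_add_closed l2_smult_closed
        intro: exI[of _ 1])
qed

lemma transport_unit_seq: "transport v (unit_seq m) = unit_seq (v m)"
proof
  fix n show "transport v (unit_seq m) n = unit_seq (v m) n"
  proof (cases "n \<in> range v")
    case True
    then obtain k where "n = v k" by blast
    then show ?thesis
      using v by (simp add: transport_apply) (simp add: unit_seq_def inj_eq)
  next
    case False
    then show ?thesis
      by (simp add: transport_outside) (auto simp: unit_seq_def)
  qed
qed

text \<open>The preimage of \<open>y\<close> is \<open>\<lambda>m. y (v m)\<close>. Equality in
  \<open>AB\<close> ensures that a \<open>y\<close> in \<open>block_space B\<close> vanishes off the
  range of \<open>v\<close>, so nothing is lost by composing with \<open>v\<close>.\<close>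

lemma transport_block_space:
  assumes AB: "v ` (block -` A) = block -` B"
  shows "transport v ` block_space A = block_space B"
proof (intro equalityI subsetI)
  fix y assume "y \<in> transport v ` block_space A"
  then obtain x where x: "x \<in> carrier l2" "\<And>n. block n \<notin> A \<Longrightarrow> x n = 0" and y: "y = transport v x"
    by (auto simp: block_space_def)
  have "y n = 0" if "block n \<notin> B" for n
  proof (cases "n \<in> range v")
    case True
    then obtain m where "n = v m" by blast
    then have "block m \<notin> A"
      using AB that by blast
    then show ?thesis
      using x \<open>n = v m\<close> by (simp add: y transport_apply)
  qed (simp add: y transport_outside x)
  then show "y \<in> block_space B"
    using x y by (auto simp: block_space_def transport_closed)
next
  fix y assume y: "y \<in> block_space B"
  have out: "y n = 0" if "n \<notin> range v" for n
  proof -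
    have "n \<notin> block -` B"
      using that by (auto simp flip: AB)
    then show ?thesis
      using y by (simp add: block_space_def)
  qed
  have x: "(\<lambda>m. y (v m)) \<in> carrier l2"
    using l2_reindex_inj(1)[OF v, of y] out y by (simp add: block_space_def)
  have "y (v m) = 0" if "block m \<notin> A" for m
  proof -
    have "v m \<notin> block -` B"
      using that v by (auto simp: inj_eq simp flip: AB)
    then show ?thesis
      using y by (simp add: block_space_def)
  qed
  then have "(\<lambda>m. y (v m)) \<in> block_space A"
    using x by (simp add: block_space_def)
  moreover have "transport v (\<lambda>m. y (v m)) = y"
  proof
    fix n show "transport v (\<lambda>m. y (v m)) n = y n"
      by (cases "n \<in> range v") (auto simp: transport_apply transport_outside x out)
  qed
  ultimately show "y \<in> transport v ` block_space A"
    by (metis imageI)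
qed

end

definition on_pairs :: "(nat \<times> nat \<Rightarrow> nat \<times> nat) \<Rightarrow> nat \<Rightarrow> nat"
  where "on_pairs f = prod_encode \<circ> f \<circ> prod_decode"

lemma on_pairs_encode [simp]: "on_pairs f (prod_encode p) = prod_encode (f p)"
  by (simp add: on_pairs_def)

lemma inj_on_pairs: "inj f \<Longrightarrow> inj (on_pairs f)"
  by (simp add: on_pairs_def inj_compose inj_prod_encode inj_prod_decode)

text \<open>Under the pairing of indices a union of blocks is the encoding of
  \<open>A \<times> UNIV\<close>, so the block condition can be checked on pairs.\<close>

lemma transport_block_isometry:
  assumes f: "inj f" and fA: "\<And>A. \<exists>B. f ` (A \<times> UNIV) = B \<times> UNIV"
  shows "transport (on_pairs f) \<in> block_isometries"
proof -
  have block: "block -` A = prod_encode ` (A \<times> UNIV)" for A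
  proof (intro equalityI subsetI)
    fix n assume "n \<in> block -` A"
    then have "prod_decode n \<in> A \<times> UNIV"
      by (cases "prod_decode n") (simp add: block_def)
    then show "n \<in> prod_encode ` (A \<times> UNIV)"
      by (metis imageI prod_decode_inverse)
  qed (auto simp: block_def)
  have "\<exists>B. transport (on_pairs f) ` block_space A = block_space B" for A
  proof -
    obtain B where B: "f ` (A \<times> UNIV) = B \<times> UNIV"
      using fA by blast
    have "on_pairs f ` (block -` A) = prod_encode ` f ` (A \<times> UNIV)"
      unfolding block image_image on_pairs_encode ..
    then have "on_pairs f ` (block -` A) = block -` B"
      unfolding block B .
    then have "transport (on_pairs f) ` block_space A = block_space B"
      by (rule transport_block_space[OF inj_on_pairs[OF f]])
    then show ?thesis ..
  qed
  then show ?thesis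
    using transport_isometry[OF inj_on_pairs[OF f]] by (simp add: block_isometries_def)
qed

section \<open>Irreducibility\<close>

lemma unit_seq_block_space: "unit_seq m \<in> block_space {block m}"
  by (simp add: block_space_def) (simp add: unit_seq_def)

text \<open>One transposition acts on the block numbers and another on the positions inside blocks;
  such a product map sends \<open>A \<times> UNIV\<close> to a set of the same shape.\<close>

lemma block_isometry_unit_seq:
  obtains V where "V \<in> block_isometries" "V (unit_seq p) = unit_seq q"
proof -
  define f where "f = map_prod (Transposition.transpose (fst (prod_decode p)) (fst (prod_decode q)))
    (Transposition.transpose (snd (prod_decode p)) (snd (prod_decode q)))"
  have f: "inj f"
    unfolding f_def by (rule prod.inj_map) (auto intro: bij_is_inj)
  have "\<exists>B. f ` (A \<times> UNIV) = B \<times> UNIV" for A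
    unfolding f_def by (rule exI, rule map_prod_surj_on[OF refl surj_transpose])
  then have "transport (on_pairs f) \<in> block_isometries"
    using f by (intro transport_block_isometry)
  moreover have "transport (on_pairs f) (unit_seq p) = unit_seq q"
    unfolding transport_unit_seq[OF inj_on_pairs[OF f]]
    by (simp add: on_pairs_def f_def map_prod_def case_prod_beta)
  ultimately show thesis
    using that by blast
qed

text \<open>A nonzero vector of \<open>M\<close> has a nonzero coordinate \<open>p\<close>. The
  reflection in the basis vector \<open>unit_seq p\<close> isolates that vector inside
  \<open>M\<close>, permutations then yield all basis vectors, and closedness gives the whole
  space.\<close>

lemma block_isometries_irreducible: "irreducible_on l2 block_isometries"
  unfolding irreducible_on_def
proof (intro allI impI)
  fix M assume M: "closed_subspace l2 M \<and> (\<forall>T\<in>block_isometries. T ` M \<subseteq> M)"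
  then have sub: "submodule M complex_ring l2"
    by (auto simp: closed_subspace_def)
  have zero: "\<zero>\<^bsub>l2\<^esub> \<in> M"
    using subgroup.one_closed[OF submodule.axioms(1)[OF sub]] by simp
  show "M = {\<zero>\<^bsub>l2\<^esub>} \<or> M = carrier l2"
  proof (cases "M = {\<zero>\<^bsub>l2\<^esub>}")
    case False
    then obtain x where x: "x \<in> M" "x \<noteq> \<zero>\<^bsub>l2\<^esub>"
      using zero by blast
    then obtain p where p: "x p \<noteq> 0"
      by auto
    have x': "x \<in> carrier l2"
      using l2.submoduleE(1)[OF sub] x(1) by blast
    have "reflection l2 (unit_seq p) \<in> block_isometries"
      by (rule reflection_block_isometry[OF unit_seq_block_space ip_unit_seq_self])
    then have "reflection l2 (unit_seq p) x \<in> M"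
      using M x(1) by blast
    \<comment> \<open>The reflected vector minus \<open>x\<close> is \<open>- 2 * x p\<close> times
      the basis vector.\<close>
    from l2.submoduleE(5)[OF sub this l2.submoduleE(3)[OF sub x(1)]]
    have "(\<lambda>n. - 2 * x p * unit_seq p n) \<in> M"
      by (simp add: reflection_def x' ip_unit_seq l2_uminus)
    from submodule.smult_closed[OF sub _ this, of "- 1 / (2 * x p)"]
    have "unit_seq p \<in> M"
      using p by (simp add: ring_of_type_algebra_def)
    then have "unit_seq q \<in> M" for q
      using block_isometry_unit_seq[of p q] M by (metis image_subset_iff)
    then show ?thesis
      using closed_subspace_all_unit_seq M by blast
  qed simp
qed

section \<open>Impossibility of a selfadjoint extension\<close>

lemma block_isometries_no_extension:
  "\<not> (\<exists>\<T>. operator_semigroup l2 \<T> \<and> (\<forall>V\<in>\<T>. partial_isometry l2 V) \<and>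
    block_isometries \<subseteq> \<T> \<and> \<T> = adj l2 ` \<T>)"
proof
  assume "\<exists>\<T>. operator_semigroup l2 \<T> \<and> (\<forall>V\<in>\<T>. partial_isometry l2 V) \<and>
    block_isometries \<subseteq> \<T> \<and> \<T> = adj l2 ` \<T>"
  then obtain \<T> where semigroup: "operator_semigroup l2 \<T>"
    and pi: "\<And>Z. Z \<in> \<T> \<Longrightarrow> partial_isometry l2 Z"
    and sub: "block_isometries \<subseteq> \<T>" and adj: "\<T> = adj l2 ` \<T>"
    by blast
  have comp: "compose (carrier l2) A B \<in> \<T>" if "A \<in> \<T>" "B \<in> \<T>" for A B
    using semigroup that by (auto simp: operator_semigroup_def)
  have bounded: "A \<in> bounded_operators l2" if "A \<in> \<T>" for A
    using semigroup that by (auto simp: operator_semigroup_def)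

  \<comment> \<open>Block 0 is distributed by parity: even positions fill block 0, odd ones block 1.
    Every other block moves up by one, where \<open>f\<close> agrees with \<open>g\<close>.\<close>
  define f :: "nat \<times> nat \<Rightarrow> nat \<times> nat"
    where "f = (\<lambda>(a, k). if a = 0 then (k mod 2, k div 2) else (Suc a, k))"
  define g :: "nat \<times> nat \<Rightarrow> nat \<times> nat" where "g = map_prod Suc id"
  define V where "V = transport (on_pairs f)"
  define W where "W = transport (on_pairs g)"
  \<comment> \<open>Both indices lie in block 0, but \<open>V\<close> separates them: it moves basis
    vector \<open>i\<close> to pair \<open>(1, 0)\<close>, where \<open>W\<close> also sends basis
    vector \<open>j\<close>, and it fixes basis vector \<open>j\<close>.\<close>
  define i where "i = prod_encode (0, 1)"
  define j where "j = prod_encode (0, 0)"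
  \<comment> \<open>The triple 3, 4, 5 gives a unit vector with rational coordinates. Its reflection
    has diagonal entry \<open>1 - 2 * (3/5)^2 = 7/25\<close> at \<open>i\<close>.\<close>
  define u where "u = (\<lambda>n. 3 / 5 * unit_seq i n + 4 / 5 * unit_seq j n)"
  define R where "R = reflection l2 u"

  have g_image: "g ` (A \<times> UNIV) = Suc ` A \<times> UNIV" for A
    unfolding g_def by (rule map_prod_surj_on) simp_all
  have g: "inj g"
    unfolding g_def by (rule prod.inj_map) simp_all
  have f: "inj f"
  proof (rule injI)
    fix p q assume "f p = f q"
    then show "p = q"
      \<comment> \<open>Images from block 0 have first component at most 1, all others at least 2.
        Within block 0, quotient and remainder modulo 2 determine \<open>k\<close>.\<close>
      by (auto simp: f_def split: prod.splits if_splits) (metis div_mult_mod_eq)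
  qed
  have fA: "\<exists>B. f ` (A \<times> UNIV) = B \<times> UNIV" for A
  proof -
    have "f ` ({0} \<times> UNIV) = {0, 1} \<times> UNIV"
    proof (intro equalityI subsetI)
      fix p :: "nat \<times> nat" assume "p \<in> {0, 1} \<times> UNIV"
      then have "p = f (0, 2 * snd p + fst p)"
        by (auto simp: f_def)
      then show "p \<in> f ` ({0} \<times> UNIV)"
        by blast
    qed (auto simp: f_def)
    moreover have "f p = g p" if "p \<in> (A - {0}) \<times> UNIV" for p
      using that by (cases p) (simp add: f_def g_def)
    then have "f ` ((A - {0}) \<times> UNIV) = g ` ((A - {0}) \<times> UNIV)"
      by (rule image_cong[OF refl])
    then have "f ` ((A - {0}) \<times> UNIV) = Suc ` (A - {0}) \<times> UNIV"
      by (simp only: g_image)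
    moreover have "f ` (A \<times> UNIV) = f ` ((A \<inter> {0}) \<times> UNIV) \<union> f ` ((A - {0}) \<times> UNIV)"
      by blast
    ultimately have "f ` (A \<times> UNIV) = ((if 0 \<in> A then {0, 1} else {}) \<union> Suc ` (A - {0})) \<times> UNIV"
      by auto
    then show ?thesis by blast
  qed
  have V: "V \<in> block_isometries"
    unfolding V_def by (rule transport_block_isometry[OF f fA])
  have W: "W \<in> block_isometries"
    unfolding W_def by (rule transport_block_isometry[OF g], rule exI, rule g_image)

  have "i \<noteq> j"
    by (simp add: i_def j_def)
  have u [simp]: "u \<in> carrier l2"
    unfolding u_def by (intro l2_add_closed l2_smult_closed unit_seq_l2)
  have "u n = 0" if "block n \<notin> {0}" for n
    using that by (auto simp: u_def unit_seq_def i_def j_def block_def)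
  then have u_block: "u \<in> block_space {0}"
    by (simp add: block_space_def)
  have u_eq: "u = (3 / 5) \<odot>\<^bsub>l2\<^esub> unit_seq i \<oplus>\<^bsub>l2\<^esub> (4 / 5) \<odot>\<^bsub>l2\<^esub> unit_seq j"
    by (simp add: u_def)
  have ip_u: "ip l2 x u = 3 / 5 * x i + 4 / 5 * x j" if "x \<in> carrier l2" for x
    unfolding u_eq using that
    by (simp del: l2_simps add: l2.ip_add_right l2.ip_smult_right l2.smult_closed' ip_unit_seq)
  have ip_uu: "ip l2 u u = 1"
    using \<open>i \<noteq> j\<close> by (simp add: ip_u) (simp add: u_def unit_seq_def)
  have R: "R \<in> block_isometries"
    unfolding R_def by (rule reflection_block_isometry[OF u_block ip_uu])

  have R_sym: "ip l2 (R x) y = ip l2 x (R y)" if "x \<in> carrier l2" "y \<in> carrier l2" for x y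
    unfolding R_def using l2.reflection_selfadjoint[OF u ip_uu] that .
  have mem: "V \<in> \<T>" "W \<in> \<T>" "R \<in> \<T>" "adj l2 V \<in> \<T>" "adj l2 W \<in> \<T>"
    using sub adj V W R by auto
  note closed [simp] = mem[THEN bounded, THEN l2.bounded_operatorD(1)]
  define Z where "Z = compose (carrier l2) (adj l2 W) (compose (carrier l2) V
    (compose (carrier l2) R (compose (carrier l2) (adj l2 V) W)))"
  have Z: "Z x = adj l2 W (V (R (adj l2 V (W x))))" if "x \<in> carrier l2" for x
    using that by (simp add: Z_def compose_eq)
  \<comment> \<open>The mirrored adjoint relation comes from conjugate symmetry, without computing
    the adjoint of an adjoint.\<close>
  have adj_right: "ip l2 (adj l2 A x) y = ip l2 x (A y)"
    if "A \<in> block_isometries" "x \<in> carrier l2" "y \<in> carrier l2" for A x y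
  proof -
    have [simp]: "adj l2 A x \<in> carrier l2" "A y \<in> carrier l2"
      using that sub adj bounded l2.bounded_operatorD(1) by blast+
    have "ip l2 (adj l2 A x) y = cnj (ip l2 y (adj l2 A x))"
      by (rule l2.ip_cnj) (simp_all add: that)
    also have "\<dots> = cnj (ip l2 (A y) x)"
      by (simp only: block_isometry_adj(1)[OF that(1,3,2)])
    also have "\<dots> = ip l2 x (A y)"
      by (rule l2.ip_cnj[symmetric]) (simp_all add: that)
    finally show ?thesis .
  qed
  have Z_sym: "ip l2 (Z x) y = ip l2 x (Z y)" if "x \<in> carrier l2" "y \<in> carrier l2" for x y
    using that by (simp add: Z adj_right V W R_sym block_isometry_adj(1)[OF V] block_isometry_adj(1)[OF W])
  have "Z \<in> \<T>"
    unfolding Z_def by (intro comp mem)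

  have adj_V: "adj l2 V (V x) = x" if "x \<in> carrier l2" for x
    using fun_cong[OF block_isometry_adj(2)[OF V], of x] that
    by (simp add: init_proj_def id_op_def compose_eq)
  have adj_W: "adj l2 W (W x) = x" if "x \<in> carrier l2" for x
    using fun_cong[OF block_isometry_adj(2)[OF W], of x] that
    by (simp add: init_proj_def id_op_def compose_eq)
  have V_unit: "V (unit_seq i) = W (unit_seq j)" "V (unit_seq j) = unit_seq j"
    unfolding V_def W_def transport_unit_seq[OF inj_on_pairs[OF f]] transport_unit_seq[OF inj_on_pairs[OF g]]
    by (simp_all add: i_def j_def f_def g_def)
  \<comment> \<open>Index \<open>j\<close> is in block 0, which the range of \<open>W\<close>
    misses, so this basis vector is orthogonal to every \<open>W z\<close>.\<close>
  have "adj l2 W (unit_seq j) = \<zero>\<^bsub>l2\<^esub>"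
  proof (rule l2.ip_eqI)
    fix z assume z: "z \<in> carrier l2"
    have "j \<notin> range (on_pairs g)"
      by (auto simp: on_pairs_def j_def g_def map_prod_def case_prod_beta)
    then have "W z j = 0"
      unfolding W_def using transport_outside[OF inj_on_pairs[OF g] z] by blast
    then show "ip l2 z (adj l2 W (unit_seq j)) = ip l2 z \<zero>\<^bsub>l2\<^esub>"
      using z by (simp add: ip_unit_seq ip_l2[of z "\<lambda>n. 0"] flip: block_isometry_adj(1)[OF W])
  qed (simp_all add: l2_zero_closed)
  moreover have "R (unit_seq i) = (7 / 25) \<odot>\<^bsub>l2\<^esub> unit_seq i \<oplus>\<^bsub>l2\<^esub> (- 24 / 25) \<odot>\<^bsub>l2\<^esub> unit_seq j"
  proof -
    have "unit_seq i i = 1" "unit_seq i j = 0"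
      using \<open>i \<noteq> j\<close> by (simp_all add: unit_seq_def)
    then have "R (unit_seq i) = (\<lambda>n. unit_seq i n + (- 6 / 5) * u n)"
      by (simp add: R_def reflection_def ip_u)
    then show ?thesis
      by (simp add: u_def fun_eq_iff algebra_simps)
  qed
  \<comment> \<open>Reading \<open>W (unit_seq j)\<close> as \<open>V (unit_seq i)\<close> lets the
    adjoint of \<open>V\<close> return \<open>unit_seq i\<close>. After \<open>R\<close> and
    \<open>V\<close>, the \<open>i\<close> component is again a multiple of
    \<open>W (unit_seq j)\<close>, and the adjoint of \<open>W\<close> takes it back to
    \<open>unit_seq j\<close> while killing the \<open>j\<close> component. Hence
    \<open>V_unit(1)\<close> is used in opposite directions in the two simplifications.\<close>
  ultimately have "Z (unit_seq j) = (7 / 25) \<odot>\<^bsub>l2\<^esub> unit_seq j"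
    using mem[THEN bounded]
    by (simp del: l2_simps add: Z adj_V adj_W l2.bounded_operatorD(3,4) l2.smult_closed' flip: V_unit(1))
       (simp add: V_unit adj_W l2.smult_closed')
  moreover have "unit_seq j \<noteq> \<zero>\<^bsub>l2\<^esub>"
    by (auto simp: unit_seq_def fun_eq_iff)
  ultimately have "(7 / 25 :: complex) ^ 4 = (7 / 25) ^ 2"
    by (intro l2.selfadjoint_partial_isometry_eigenvalue[OF pi[OF \<open>Z \<in> \<T>\<close>] Z_sym unit_seq_l2])
  then show False
    by (simp add: field_simps)
qed

theorem theorem3p3:
  shows "\<exists>(H :: (nat \<Rightarrow> complex) hilbert) \<S>.
    complex_hilbert_space H \<and> infinite_dimensional H \<and> separable_space (htopology H) \<and>
    operator_semigroup H \<S> \<and> id_op H \<in> \<S> \<and> (\<forall>V\<in>\<S>. isometry H V) \<and> irreducible_on H \<S> \<and>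
    commuting_projections H (init_proj H ` \<S> \<union> range_proj H ` \<S>) \<and>
    \<not> (\<exists>\<T>. operator_semigroup H \<T> \<and> (\<forall>V\<in>\<T>. partial_isometry H V) \<and>
           \<S> \<subseteq> \<T> \<and> \<T> = adj H ` \<T>)"
proof (intro exI conjI)
  show "\<forall>V\<in>block_isometries. isometry l2 V"
    by (simp add: block_isometries_def)
qed (rule complex_hilbert_space_l2 infinite_dimensional_l2 separable_l2 block_isometries_semigroup
    id_block_isometry block_isometries_irreducible block_isometries_commuting
    block_isometries_no_extension)+

end
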